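(* Let $n\ge2$, $\alpha_0,\alpha_1>0$, and let $X_1,\dots,X_n$ be i.i.d. $\mathrm{Pareto}(m,\alpha)$ with $m\in(0,\infty)$, $\alpha>0$. Consider testing the null $H_0:\alpha=\alpha_0$ (with $m\in(0,\infty)$ arbitrary) against the alternative $H_1:\alpha=\alpha_1$ (with $m\in(0,\infty)$ arbitrary). Write $X_{(1)}=\min(X_1,\dots,X_n)$. If $n\alpha_1>1$, then $$E^*=\left(\frac{\alpha_1}{\alpha_0}\right)^{n-1}\exp\left(-(\alpha_1-\alpha_0)\sum_{i=1}^n\log\frac{X_i}{X_{(1)}}\right)$$ is a GROW e-variable for this testing problem; that is, $E^*$ is an e-variable for $H_0$ and $$\inf_{m\in(0,\infty)}\mathbb{E}_{m,\alpha_1}[\log(E^* )]=\sup_{E\in\mathcal{E}}\ \inf_{m\in(0,\infty)}\mathbb{E}_{m,\alpha_1}[\log(E)],$$ where $\mathcal{E}$ is the set of all e-variables for $H_0$.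
   Context: $\mathrm{Pareto}(m,\alpha)$ is the distribution on $\mathbb{R}$ with Lebesgue density $x\mapsto\frac{\alpha m^\alpha}{x^{\alpha+1}}\mathbf{1}\{x\ge m\}$. $\mathbb{E}_{m,\alpha}$ denotes expectation when $X_1,\dots,X_n$ are i.i.d. $\mathrm{Pareto}(m,\alpha)$. An e-variable for $H_0$ is a $[0,\infty]$-valued measurable function $E$ of $(X_1,\dots,X_n)$ with $\mathbb{E}_{m,\alpha_0}[E]\le1$ for all $m\in(0,\infty)$. Conventions: $\log0=-\infty$, $\log\infty=\infty$; an expectation $\mathbb{E}[Z]$ is defined in $[-\infty,\infty]$ when $\mathbb{E}[Z^+]$ or $\mathbb{E}[Z^-]$ is finite (which holds for $\log E$ under every $(m,\alpha_1)$ and every $E\in\mathcal{E}$ in this setting). *)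

theory Defs
  imports "HOL-Probability.Probability"
begin

definition pareto_density :: "real \<Rightarrow> real \<Rightarrow> real \<Rightarrow> real" where
  "pareto_density m \<alpha> x = \<alpha> * m powr \<alpha> / x powr (\<alpha> + 1) * indicator {m..} x"

definition pareto :: "real \<Rightarrow> real \<Rightarrow> real measure" where
  "pareto m \<alpha> = density lborel (\<lambda>x. ennreal (pareto_density m \<alpha> x))"

text \<open>The joint law of $X_1, \dots, X_n$. The sample is modelled canonically: a sample is a point
  \<open>x\<close> of the product space over the index set \<open>{1..n}\<close>, and \<open>X_i\<close> is the coordinate \<open>x i\<close>.\<close>

definition pareto_sample :: "nat \<Rightarrow> real \<Rightarrow> real \<Rightarrow> (nat \<Rightarrow> real) measure" where
  "pareto_sample n m \<alpha> = (\<Pi>\<^sub>M i\<in>{1..n}. pareto m \<alpha>)"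

text \<open>The logarithm $[0,\infty] \to [-\infty,\infty]$ with $\log 0 = -\infty$ and
  $\log\infty = \infty$.\<close>

definition ln_ennreal :: "ennreal \<Rightarrow> ereal" where
  "ln_ennreal x = (if x = 0 then -\<infinity> else if x = \<infinity> then \<infinity> else ereal (ln (enn2real x)))"

text \<open>$E[Z] = E[Z^+] - E[Z^-]$ in $[-\infty,\infty]$; here \<open>e2ennreal\<close> truncates negative values to
  0, so it takes the positive part. The value is meaningful when one of the two terms is finite;
  otherwise it is the junk value $\infty - \infty = \infty$ of type \<open>ereal\<close>.
  For the log of an e-variable against a fixed Pareto null, the positive part has finite
  expectation under every alternative considered below, so the junk case never arises there.\<close>

definition ext_expectation :: "'a measure \<Rightarrow> ('a \<Rightarrow> ereal) \<Rightarrow> ereal" where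
  "ext_expectation M Z =
     enn2ereal (\<integral>\<^sup>+ x. e2ennreal (Z x) \<partial>M) - enn2ereal (\<integral>\<^sup>+ x. e2ennreal (- Z x) \<partial>M)"

definition e_variables :: "nat \<Rightarrow> real \<Rightarrow> ((nat \<Rightarrow> real) \<Rightarrow> ennreal) set" where
  "e_variables n \<alpha>0 =
     {E. E \<in> borel_measurable (\<Pi>\<^sub>M i\<in>{1..n}. borel) \<and>
         (\<forall>m>0. (\<integral>\<^sup>+ x. E x \<partial>pareto_sample n m \<alpha>0) \<le> 1)}"

definition worst_case_growth :: "nat \<Rightarrow> real \<Rightarrow> ((nat \<Rightarrow> real) \<Rightarrow> ennreal) \<Rightarrow> ereal" where
  "worst_case_growth n \<alpha>1 E =
     (INF m\<in>{0<..}. ext_expectation (pareto_sample n m \<alpha>1) (\<lambda>x. ln_ennreal (E x)))"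

definition GROW_e_variable ::
    "nat \<Rightarrow> real \<Rightarrow> real \<Rightarrow> ((nat \<Rightarrow> real) \<Rightarrow> ennreal) \<Rightarrow> bool" where
  "GROW_e_variable n \<alpha>0 \<alpha>1 E \<longleftrightarrow>
     E \<in> e_variables n \<alpha>0 \<and>
     worst_case_growth n \<alpha>1 E = (SUP E'\<in>e_variables n \<alpha>0. worst_case_growth n \<alpha>1 E')"

definition sample_min :: "nat \<Rightarrow> (nat \<Rightarrow> real) \<Rightarrow> real" where
  "sample_min n x = Min (x ` {1..n})"

definition E_star :: "nat \<Rightarrow> real \<Rightarrow> real \<Rightarrow> (nat \<Rightarrow> real) \<Rightarrow> ennreal" where
  "E_star n \<alpha>0 \<alpha>1 x =
     ennreal ((\<alpha>1 / \<alpha>0) ^ (n - 1) *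
       exp (- (\<alpha>1 - \<alpha>0) * (\<Sum>i=1..n. ln (x i / sample_min n x))))"

end

(* Put the prior Pareto(1, n \<alpha>0) on m under the alternative and Pareto(1, n \<alpha>1) under the null.
   With these crossed priors the sample minimum has the same law under both mixtures, and it is
   independent of the ratios X_i / X_(1), so the likelihood ratio of the mixtures is exactly E*.
   Hence the mean of E / E* under the alternative mixture is E's mean under the null mixture, which
   is at most 1, so E / E* has mean at most 1 under the alternative for at least one m. For that m,
   integrating log E \<le> log E* + E / E* - 1 bounds E's growth by that of E*, which does not depend
   on m because E* is scale invariant. *)

theory Submission
  imports Defs
begin

section \<open>Pareto samples\<close>

lemma pareto_density_nonneg: "0 < \<alpha> \<Longrightarrow> 0 \<le> pareto_density m \<alpha> x"
  by (simp add: pareto_density_def)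

lemma borel_measurable_pareto_density [measurable]: "pareto_density m \<alpha> \<in> borel_measurable borel"
  unfolding pareto_density_def by measurable

lemma sets_pareto [simp, measurable_cong]: "sets (pareto m \<alpha>) = sets borel"
  by (simp add: pareto_def)

lemma space_pareto [simp]: "space (pareto m \<alpha>) = UNIV"
  by (simp add: pareto_def)

lemma nn_integral_pareto_density:
  assumes "0 < m" "0 < \<alpha>"
  shows "(\<integral>\<^sup>+x. ennreal (pareto_density m \<alpha> x) \<partial>lborel) = 1"
proof -
  have "(\<integral>\<^sup>+x. ennreal (pareto_density m \<alpha> x) \<partial>lborel) =
      (\<integral>\<^sup>+x. ennreal (\<alpha> * m powr \<alpha> / x powr (\<alpha> + 1)) * indicator {m..} x \<partial>lborel)"
    by (intro nn_integral_cong) (auto simp: pareto_density_def split: split_indicator)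
  also have "\<dots> = ennreal (0 - (- (m powr \<alpha> * m powr (- \<alpha>))))"
  proof (rule nn_integral_FTC_atLeast[where F = "\<lambda>x. - (m powr \<alpha> * x powr (- \<alpha>))"])
    show "((\<lambda>x. - (m powr \<alpha> * x powr (- \<alpha>))) has_real_derivative \<alpha> * m powr \<alpha> / x powr (\<alpha> + 1)) (at x)"
      if "m \<le> x" for x
    proof -
      have "0 < x" using that assms by linarith
      then show ?thesis
        by (auto intro!: derivative_eq_intros
            simp: powr_add powr_diff powr_minus divide_simps)
    qed
    have "((\<lambda>x. x powr (- \<alpha>)) \<longlongrightarrow> 0) at_top"
      using assms by (intro tendsto_neg_powr filterlim_ident) auto
    from tendsto_minus[OF tendsto_mult_right_zero[OF this, of "m powr \<alpha>"]]
    show "((\<lambda>x. - (m powr \<alpha> * x powr - \<alpha>)) \<longlongrightarrow> 0) at_top" by simp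
  qed (use assms in auto)
  also have "\<dots> = 1"
    using assms by (simp add: powr_add [symmetric])
  finally show ?thesis .
qed

lemma prob_space_pareto:
  assumes "0 < m" "0 < \<alpha>"
  shows "prob_space (pareto m \<alpha>)"
  by (rule prob_spaceI) (simp add: pareto_def emeasure_density nn_integral_pareto_density assms)

text \<open>Beyond t the law is again Pareto with the same shape and minimum t, and the factor is
  the probability of exceeding t. Tail probabilities thus reduce to the normalisation of the
  density.\<close>

lemma pareto_density_tail:
  assumes "0 < m" "m \<le> t" "t \<le> x"
  shows "pareto_density m \<alpha> x = (m / t) powr \<alpha> * pareto_density t \<alpha> x"
  using assms by (simp add: pareto_density_def powr_divide)

lemma emeasure_pareto_greaterThan:
  assumes "0 < m" "0 < \<alpha>" "m \<le> t"
  shows "emeasure (pareto m \<alpha>) {t<..} = ennreal ((m / t) powr \<alpha>)"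
proof -
  have "emeasure (pareto m \<alpha>) {t<..} =
      (\<integral>\<^sup>+x. ennreal (pareto_density m \<alpha> x) * indicator {t<..} x \<partial>lborel)"
    by (simp add: pareto_def emeasure_density)
  also have "\<dots> = (\<integral>\<^sup>+x. ennreal ((m / t) powr \<alpha>) * ennreal (pareto_density t \<alpha> x) \<partial>lborel)"
  proof (intro nn_integral_cong_AE)
    \<comment> \<open>The two integrands differ at t itself: \<open>{t<..}\<close> omits that point,
      whereas the density with minimum t is positive there.\<close>
    have "AE x in lborel. x \<noteq> t" by (rule AE_lborel_singleton)
    then show "AE x in lborel. ennreal (pareto_density m \<alpha> x) * indicator {t<..} x =
        ennreal ((m / t) powr \<alpha>) * ennreal (pareto_density t \<alpha> x)"
    proof eventually_elim
      case (elim x)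
      then consider "t < x" | "x < t" by linarith
      then show ?case
      proof cases
        case 1
        then show ?thesis
          using assms by (simp add: pareto_density_tail[of m t x] ennreal_mult')
      qed (simp add: pareto_density_def)
    qed
  qed
  also have "\<dots> = ennreal ((m / t) powr \<alpha>)"
    using assms by (simp add: nn_integral_cmult nn_integral_pareto_density)
  finally show ?thesis .
qed

text \<open>In the change of variables from x to m x the Jacobian m exactly absorbs the surplus
  power of m in the density, so m is a pure scale parameter.\<close>

lemma pareto_scale:
  assumes "0 < m"
  shows "pareto m \<alpha> = distr (pareto 1 \<alpha>) borel ((*) m)"
proof -
  have dens: "pareto_density m \<alpha> (m * x) * m = pareto_density 1 \<alpha> x" for x
    using assms
    by (cases "1 \<le> x") (auto simp: pareto_density_def powr_mult powr_add indicator_def field_simps)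
  \<comment> \<open>Lebesgue measure is |m| times its image under multiplication by m; in this form
    the density can be pulled back through the map.\<close>
  have "pareto m \<alpha> = density (density (distr lborel borel ((*) m)) (\<lambda>_. ennreal \<bar>m\<bar>))
      (\<lambda>x. ennreal (pareto_density m \<alpha> x))"
    using lborel_distr_mult'[of m] assms by (simp add: pareto_def)
  also have "\<dots> = density (distr lborel borel ((*) m)) (\<lambda>x. ennreal (pareto_density m \<alpha> x * m))"
    using assms by (simp add: density_density_eq ennreal_mult' mult.commute)
  also have "\<dots> = distr (density lborel (\<lambda>x. ennreal (pareto_density m \<alpha> (m * x) * m))) borel ((*) m)"
    by (rule density_distr) auto
  also have "\<dots> = distr (pareto 1 \<alpha>) borel ((*) m)"
    by (simp add: dens pareto_def)
  finally show ?thesis .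
qed

section \<open>The product law of the sample\<close>

lemma sets_pareto_sample [simp, measurable_cong]:
  "sets (pareto_sample n m \<alpha>) = sets (\<Pi>\<^sub>M i\<in>{1..n}. borel)"
  unfolding pareto_sample_def by (intro sets_PiM_cong) auto

lemma space_pareto_sample:
  "space (pareto_sample n m \<alpha>) = PiE {1..n} (\<lambda>_. UNIV)"
  by (simp add: pareto_sample_def space_PiM)

lemma emeasure_pareto_sample_PiE:
  assumes "0 < m" "0 < \<alpha>" "\<And>i. i \<in> {1..n} \<Longrightarrow> A i \<in> sets borel"
  shows "emeasure (pareto_sample n m \<alpha>) (PiE {1..n} A) = (\<Prod>i\<in>{1..n}. emeasure (pareto m \<alpha>) (A i))"
proof -
  interpret prob_space "pareto m \<alpha>" by (intro prob_space_pareto assms)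
  interpret product_prob_space "\<lambda>_::nat. pareto m \<alpha>" ..
  show ?thesis
    unfolding pareto_sample_def using assms by (intro emeasure_PiM) auto
qed

lemma prob_space_pareto_sample:
  assumes "0 < m" "0 < \<alpha>"
  shows "prob_space (pareto_sample n m \<alpha>)"
  unfolding pareto_sample_def by (intro prob_space_PiM prob_space_pareto assms)

lemma pareto_sample_scale:
  assumes "0 < m" "0 < \<alpha>"
  shows "pareto_sample n m \<alpha> =
    distr (pareto_sample n 1 \<alpha>) (\<Pi>\<^sub>M i\<in>{1..n}. borel) (compose {1..n} ((*) m))"
proof -
  have 1: "prob_space (pareto 1 \<alpha>)" and m: "prob_space (pareto m \<alpha>)"
    using assms by (auto intro: prob_space_pareto)
  \<comment> \<open>The product rule wants probability spaces as targets, so the codomain is first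
    \<open>pareto m \<alpha>\<close>; \<open>distr\<close> sees only its sigma-algebra, which is
    that of \<open>borel\<close>.\<close>
  have "distr (pareto_sample n 1 \<alpha>) (\<Pi>\<^sub>M i\<in>{1..n}. pareto m \<alpha>) (compose {1..n} ((*) m)) =
      (\<Pi>\<^sub>M i\<in>{1..n}. distr (pareto 1 \<alpha>) (pareto m \<alpha>) ((*) m))"
    unfolding pareto_sample_def by (rule distr_PiM_finite_prob_space') (use 1 m in auto)
  also have "distr (pareto 1 \<alpha>) (pareto m \<alpha>) ((*) m) = distr (pareto 1 \<alpha>) borel ((*) m)"
    by (intro distr_cong) auto
  also have "\<dots> = pareto m \<alpha>"
    using pareto_scale[OF assms(1)] by simp
  also have "distr (pareto_sample n 1 \<alpha>) (\<Pi>\<^sub>M i\<in>{1..n}. pareto m \<alpha>) (compose {1..n} ((*) m)) =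
      distr (pareto_sample n 1 \<alpha>) (\<Pi>\<^sub>M i\<in>{1..n}. borel) (compose {1..n} ((*) m))"
    by (intro distr_cong sets_PiM_cong) auto
  finally show ?thesis
    by (simp add: pareto_sample_def)
qed

section \<open>Lebesgue densities of the sample\<close>

definition joint_density :: "nat \<Rightarrow> real \<Rightarrow> real \<Rightarrow> (nat \<Rightarrow> real) \<Rightarrow> real" where
  "joint_density n m \<alpha> x = (\<Prod>i\<in>{1..n}. pareto_density m \<alpha> (x i))"

lemma joint_density_nonneg: "0 < \<alpha> \<Longrightarrow> 0 \<le> joint_density n m \<alpha> x"
  unfolding joint_density_def by (intro prod_nonneg) (auto simp: pareto_density_nonneg)

text \<open>Tonelli over prior and sample needs measurability in m and x together. The indicator of
  \<open>{m..}\<close>, a set that moves with m, becomes a comparison of two measurable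
  functions.\<close>

lemma borel_measurable_joint_density:
  "(\<lambda>(m, x). joint_density n m \<alpha> x) \<in> borel_measurable (borel \<Otimes>\<^sub>M (\<Pi>\<^sub>M i\<in>{1..n}. lborel))"
proof -
  have "(\<lambda>(m, x). joint_density n m \<alpha> x) =
      (\<lambda>p. \<Prod>i\<in>{1..n}. \<alpha> * fst p powr \<alpha> / (snd p i) powr (\<alpha> + 1) *
        (if fst p \<le> snd p i then 1 else 0))"
    by (auto simp: joint_density_def pareto_density_def fun_eq_iff indicator_def intro!: prod.cong)
  also have "\<dots> \<in> borel_measurable (borel \<Otimes>\<^sub>M (\<Pi>\<^sub>M i\<in>{1..n}. lborel))"
    by measurable
  finally show ?thesis .
qed

lemma borel_measurable_joint_density' [measurable]:
  "joint_density n m \<alpha> \<in> borel_measurable (\<Pi>\<^sub>M i\<in>{1..n}. lborel)"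
  unfolding joint_density_def by measurable

text \<open>Both measures agree on boxes, where the integrand factorises over the coordinates. All
  sample laws thereby get one dominating measure, and changing the shape becomes multiplication by a
  likelihood ratio.\<close>

lemma pareto_sample_density:
  assumes "0 < m" "0 < \<alpha>"
  shows "pareto_sample n m \<alpha> =
    density (\<Pi>\<^sub>M i\<in>{1..n}. lborel) (\<lambda>x. ennreal (joint_density n m \<alpha> x))"
proof -
  interpret prob_space "pareto m \<alpha>" by (intro prob_space_pareto assms)
  interpret product_prob_space "\<lambda>_::nat. pareto m \<alpha>" ..
  interpret L: product_sigma_finite "\<lambda>_::nat. lborel :: real measure" ..
  show ?thesis
    unfolding pareto_sample_def
  proof (rule PiM_eqI[symmetric])
    show "sets (density (\<Pi>\<^sub>M i\<in>{1..n}. lborel) (\<lambda>x. ennreal (joint_density n m \<alpha> x))) =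
        sets (\<Pi>\<^sub>M i\<in>{1..n}. pareto m \<alpha>)"
      unfolding sets_density by (intro sets_PiM_cong) auto
    fix A :: "nat \<Rightarrow> real set"
    assume "\<And>i. i \<in> {1..n} \<Longrightarrow> A i \<in> sets (pareto m \<alpha>)"
    then have A [measurable]: "\<And>i. i \<in> {1..n} \<Longrightarrow> A i \<in> sets borel" by simp
    have [measurable]: "PiE {1..n} A \<in> sets (\<Pi>\<^sub>M i\<in>{1..n}. lborel)"
      by (intro sets_PiM_I_finite) (auto simp: A)
    have "emeasure (density (\<Pi>\<^sub>M i\<in>{1..n}. lborel) (\<lambda>x. ennreal (joint_density n m \<alpha> x))) (PiE {1..n} A)
        = (\<integral>\<^sup>+x. ennreal (joint_density n m \<alpha> x) * indicator (PiE {1..n} A) x \<partial>(\<Pi>\<^sub>M i\<in>{1..n}. lborel))"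
      by (intro emeasure_density) measurable
    also have "\<dots> = (\<integral>\<^sup>+x. (\<Prod>i\<in>{1..n}. ennreal (pareto_density m \<alpha> (x i)) * indicator (A i) (x i))
        \<partial>(\<Pi>\<^sub>M i\<in>{1..n}. lborel))"
    proof (rule nn_integral_cong)
      fix x :: "nat \<Rightarrow> real" assume "x \<in> space (\<Pi>\<^sub>M i\<in>{1..n}. lborel)"
      then have "x \<in> extensional {1..n}" by (simp add: space_PiM PiE_def)
      then have "indicator (PiE {1..n} A) x = (\<Prod>i\<in>{1..n}. indicator (A i) (x i) :: ennreal)"
        by (cases "x \<in> PiE {1..n} A")
          (auto simp: indicator_def PiE_iff intro!: prod_zero[symmetric])
      then show "ennreal (joint_density n m \<alpha> x) * indicator (PiE {1..n} A) x =
          (\<Prod>i\<in>{1..n}. ennreal (pareto_density m \<alpha> (x i)) * indicator (A i) (x i))"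
        using assms
        by (simp add: joint_density_def prod.distrib prod_ennreal pareto_density_nonneg)
    qed
    also have "\<dots> = (\<Prod>i\<in>{1..n}. \<integral>\<^sup>+x. ennreal (pareto_density m \<alpha> x) * indicator (A i) x \<partial>lborel)"
      by (intro L.product_nn_integral_prod) auto
    also have "\<dots> = (\<Prod>i\<in>{1..n}. emeasure (pareto m \<alpha>) (A i))"
      by (intro prod.cong) (auto simp: pareto_def emeasure_density)
    finally show "emeasure (density (\<Pi>\<^sub>M i\<in>{1..n}. lborel) (\<lambda>x. ennreal (joint_density n m \<alpha> x)))
        (PiE {1..n} A) = (\<Prod>i\<in>{1..n}. emeasure (pareto m \<alpha>) (A i))" .
  qed simp
qed

lemma sets_PiM_lborel: "sets (\<Pi>\<^sub>M i\<in>I. lborel) = sets (\<Pi>\<^sub>M i\<in>I. borel)"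
  by (intro sets_PiM_cong) auto

lemma nn_integral_pareto_sample:
  assumes "0 < m" "0 < \<alpha>" "F \<in> borel_measurable (\<Pi>\<^sub>M i\<in>{1..n}. borel)"
  shows "(\<integral>\<^sup>+x. F x \<partial>pareto_sample n m \<alpha>) =
    (\<integral>\<^sup>+x. ennreal (joint_density n m \<alpha> x) * F x \<partial>(\<Pi>\<^sub>M i\<in>{1..n}. lborel))"
proof -
  have F: "F \<in> borel_measurable (\<Pi>\<^sub>M i\<in>{1..n}. lborel)"
    using assms(3) by (simp add: measurable_cong_sets[OF sets_PiM_lborel refl])
  have d: "(\<lambda>x. ennreal (joint_density n m \<alpha> x)) \<in> borel_measurable (\<Pi>\<^sub>M i\<in>{1..n}. lborel)"
    by measurable
  show ?thesis
    unfolding pareto_sample_density[OF assms(1,2)] by (rule nn_integral_density[OF d F])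
qed

section \<open>The sample minimum and \<open>E*\<close>\<close>

lemma sample_min_le: "i \<in> {1..n} \<Longrightarrow> sample_min n x \<le> x i"
  by (auto simp: sample_min_def)

lemma le_sample_min_iff: "1 \<le> n \<Longrightarrow> t \<le> sample_min n x \<longleftrightarrow> (\<forall>i\<in>{1..n}. t \<le> x i)"
  by (auto simp: sample_min_def)

lemma less_sample_min_iff: "1 \<le> n \<Longrightarrow> t < sample_min n x \<longleftrightarrow> (\<forall>i\<in>{1..n}. t < x i)"
  by (auto simp: sample_min_def)

lemma borel_measurable_sample_min [measurable]:
  "sample_min n \<in> borel_measurable (\<Pi>\<^sub>M i\<in>{1..n}. borel)"
  unfolding sample_min_def by measurable

lemma borel_measurable_E_star [measurable]:
  "E_star n \<alpha>0 \<alpha>1 \<in> borel_measurable (\<Pi>\<^sub>M i\<in>{1..n}. borel)"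
  unfolding E_star_def by measurable

lemma joint_density_eq_0:
  assumes "1 \<le> n" "sample_min n x < m"
  shows "joint_density n m \<alpha> x = 0"
proof -
  obtain i where "i \<in> {1..n}" "x i < m"
    using assms le_sample_min_iff[of n m x] by force
  then show ?thesis
    unfolding joint_density_def
    by (intro prod_zero) (auto simp: pareto_density_def intro!: bexI[of _ i])
qed

text \<open>Once all support constraints hold, the data enter only through the product of the
  coordinates; the minimum acts only through the support.\<close>

lemma joint_density_eq:
  assumes "1 \<le> n" "0 < m" "m \<le> sample_min n x"
  shows "joint_density n m \<alpha> x =
    \<alpha> ^ n * m powr (real n * \<alpha>) * (\<Prod>i\<in>{1..n}. x i) powr (- (\<alpha> + 1))"
proof -
  have x: "m \<le> x i" if "i \<in> {1..n}" for i
    using assms that by (simp add: le_sample_min_iff)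
  have "joint_density n m \<alpha> x = (\<Prod>i\<in>{1..n}. \<alpha> * m powr \<alpha> * x i powr (- (\<alpha> + 1)))"
    unfolding joint_density_def
  proof (rule prod.cong)
    fix i assume "i \<in> {1..n}"
    then have "m \<le> x i" by (rule x)
    then show "pareto_density m \<alpha> (x i) = \<alpha> * m powr \<alpha> * x i powr (- (\<alpha> + 1))"
      using powr_minus_divide[of "x i" "\<alpha> + 1"] by (simp add: pareto_density_def)
  qed simp
  also have "\<dots> = \<alpha> ^ n * (m powr \<alpha>) ^ n * (\<Prod>i\<in>{1..n}. x i powr (- (\<alpha> + 1)))"
    by (simp only: prod.distrib prod_constant card_atLeastAtMost) simp
  also have "(m powr \<alpha>) ^ n = m powr (real n * \<alpha>)"
    using assms by (simp add: powr_realpow[symmetric] powr_powr mult.commute)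
  also have "(\<Prod>i\<in>{1..n}. x i powr (- (\<alpha> + 1))) = (\<Prod>i\<in>{1..n}. x i) powr (- (\<alpha> + 1))"
    by (rule prod_powr_distrib[symmetric])
  finally show ?thesis .
qed

text \<open>The sum of the log ratios is the log of the product minus n times the log of the
  minimum. In this power form \<open>E_star\<close> combines with the likelihood by adding
  exponents.\<close>

lemma E_star_eq:
  assumes "1 \<le> n" "0 < sample_min n x"
  shows "E_star n \<alpha>0 \<alpha>1 x = ennreal ((\<alpha>1 / \<alpha>0) ^ (n - 1) *
    (sample_min n x powr (real n * (\<alpha>1 - \<alpha>0)) * (\<Prod>i\<in>{1..n}. x i) powr (- (\<alpha>1 - \<alpha>0))))"
proof -
  let ?y = "sample_min n x"
  have x: "0 < x i" if "i \<in> {1..n}" for i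
    using assms sample_min_le[OF that, of x] by linarith
  have P: "0 < (\<Prod>i\<in>{1..n}. x i)" using x by (intro prod_pos) auto
  have "(\<Sum>i=1..n. ln (x i / ?y)) = (\<Sum>i=1..n. ln (x i) - ln ?y)"
    by (intro sum.cong refl ln_divide_pos x assms(2))
  also have "\<dots> = ln (\<Prod>i\<in>{1..n}. x i) - real n * ln ?y"
    using x by (subst ln_prod) (force simp: sum_subtractf)+
  finally have S: "(\<Sum>i=1..n. ln (x i / ?y)) = ln (\<Prod>i\<in>{1..n}. x i) - real n * ln ?y" .
  have exp_eq: "exp (- d * (ln p - k * ln y)) = y powr (k * d) * p powr (- d)"
    if "0 < p" "0 < y" for p y d k :: real
    using that by (simp add: powr_def exp_add[symmetric] algebra_simps)
  show ?thesis
    unfolding E_star_def S exp_eq[OF P assms(2)] ..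
qed

text \<open>\<open>E_star\<close> is the full likelihood ratio at m divided by the likelihood ratio
  of the sample minimum. The factor on the right is the inverse of the latter: the density of
  Pareto(m, n \<alpha>0) over that of Pareto(m, n \<alpha>1), at the minimum. Below m both sides
  vanish.\<close>

lemma joint_density_E_star:
  assumes "1 \<le> n" "0 < m" "0 < \<alpha>0" "0 < \<alpha>1"
  shows "ennreal (joint_density n m \<alpha>0 x) * E_star n \<alpha>0 \<alpha>1 x =
    ennreal (\<alpha>0 / \<alpha>1 * (sample_min n x / m) powr (real n * (\<alpha>1 - \<alpha>0))) *
    ennreal (joint_density n m \<alpha>1 x)"
proof (cases "m \<le> sample_min n x")
  case True
  then have y: "0 < sample_min n x" using assms by linarith
  let ?P = "\<Prod>i\<in>{1..n}. x i"
  \<comment> \<open>The exponent n - 1 is one short of the n in the likelihood, which leaves the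
    factor \<alpha>0 / \<alpha>1.\<close>
  have pow: "\<alpha>0 ^ n * (\<alpha>1 / \<alpha>0) ^ (n - 1) = \<alpha>0 / \<alpha>1 * \<alpha>1 ^ n"
  proof -
    obtain k where "n = Suc k" using assms by (cases n) auto
    then show ?thesis using assms by (simp add: field_simps)
  qed
  have "joint_density n m \<alpha>0 x * ((\<alpha>1 / \<alpha>0) ^ (n - 1) *
      (sample_min n x powr (real n * (\<alpha>1 - \<alpha>0)) * ?P powr (- (\<alpha>1 - \<alpha>0)))) =
      (\<alpha>0 ^ n * (\<alpha>1 / \<alpha>0) ^ (n - 1)) * m powr (real n * \<alpha>0) *
      sample_min n x powr (real n * (\<alpha>1 - \<alpha>0)) *
      (?P powr (- (\<alpha>0 + 1)) * ?P powr (- (\<alpha>1 - \<alpha>0)))"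
    using assms True by (simp add: joint_density_eq)
  also have "?P powr (- (\<alpha>0 + 1)) * ?P powr (- (\<alpha>1 - \<alpha>0)) = ?P powr (- (\<alpha>1 + 1))"
    by (simp add: powr_add[symmetric] algebra_simps)
  also have "m powr (real n * \<alpha>0) = m powr (real n * \<alpha>1) * m powr (- (real n * (\<alpha>1 - \<alpha>0)))"
    by (simp add: powr_add[symmetric] algebra_simps)
  also have "\<alpha>0 ^ n * (\<alpha>1 / \<alpha>0) ^ (n - 1) = \<alpha>0 / \<alpha>1 * \<alpha>1 ^ n"
    by (rule pow)
  finally have "joint_density n m \<alpha>0 x * ((\<alpha>1 / \<alpha>0) ^ (n - 1) *
      (sample_min n x powr (real n * (\<alpha>1 - \<alpha>0)) * ?P powr (- (\<alpha>1 - \<alpha>0)))) =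
      \<alpha>0 / \<alpha>1 * (sample_min n x / m) powr (real n * (\<alpha>1 - \<alpha>0)) * joint_density n m \<alpha>1 x"
    using assms True y
    by (simp add: joint_density_eq powr_divide powr_minus_divide del: minus_diff_eq)
  then show ?thesis
    using assms y by (simp add: E_star_eq ennreal_mult'[symmetric] joint_density_nonneg)
qed (use assms in \<open>simp add: joint_density_eq_0\<close>)

text \<open>Exchanging the shapes inverts the prefactor and negates the exponent. The reciprocal of
  \<open>E_star\<close> is thus an \<open>E_star\<close> again, and no division in
  \<open>ennreal\<close> is needed.\<close>

lemma E_star_cancel:
  assumes "0 < \<alpha>0" "0 < \<alpha>1"
  shows "E_star n \<alpha>0 \<alpha>1 x * E_star n \<alpha>1 \<alpha>0 x = 1"
proof -
  have "(\<alpha>1 / \<alpha>0) ^ (n - 1) * (\<alpha>0 / \<alpha>1) ^ (n - 1) = 1"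
    using assms by (simp add: power_mult_distrib[symmetric])
  then show ?thesis
    using assms
    by (simp add: E_star_def ennreal_mult'[symmetric] exp_add[symmetric] algebra_simps)
qed

section \<open>The law of the sample minimum and the mean of \<open>E_star\<close>\<close>

lemma emeasure_sample_min_greaterThan:
  assumes "1 \<le> n" "0 < m" "0 < \<alpha>"
  shows "emeasure (distr (pareto_sample n m \<alpha>) borel (sample_min n)) {t<..} =
    emeasure (pareto m \<alpha>) {t<..} ^ n"
proof -
  have "emeasure (distr (pareto_sample n m \<alpha>) borel (sample_min n)) {t<..} =
      emeasure (pareto_sample n m \<alpha>) (sample_min n -` {t<..} \<inter> space (pareto_sample n m \<alpha>))"
    by (intro emeasure_distr) auto
  also have "sample_min n -` {t<..} \<inter> space (pareto_sample n m \<alpha>) = PiE {1..n} (\<lambda>_. {t<..})"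
    using assms by (auto simp: space_pareto_sample less_sample_min_iff PiE_iff)
  also have "emeasure (pareto_sample n m \<alpha>) \<dots> = emeasure (pareto m \<alpha>) {t<..} ^ n"
    using assms by (subst emeasure_pareto_sample_PiE) auto
  finally show ?thesis .
qed

text \<open>The n-th power of a Pareto tail is the Pareto tail with n times the shape, and a
  distribution on the line is determined by its tails.\<close>

lemma distr_sample_min:
  assumes "1 \<le> n" "0 < m" "0 < \<alpha>"
  shows "distr (pareto_sample n m \<alpha>) borel (sample_min n) = pareto m (real n * \<alpha>)"
    (is "?D = ?P")
proof (rule cdf_unique)
  interpret S: prob_space "pareto_sample n m \<alpha>" by (intro prob_space_pareto_sample assms)
  interpret P: prob_space ?P using assms by (intro prob_space_pareto) auto
  interpret P1: prob_space "pareto m \<alpha>" using assms by (intro prob_space_pareto) auto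
  show D: "real_distribution ?D" by (rule S.real_distribution_distr) measurable
  then interpret D: real_distribution ?D .
  show P: "real_distribution ?P" by unfold_locales simp
  then interpret P: real_distribution ?P .
  have tail: "emeasure ?D {t<..} = emeasure ?P {t<..}" for t
  proof (cases "m \<le> t")
    case True
    then show ?thesis
      using assms
      by (simp add: emeasure_sample_min_greaterThan emeasure_pareto_greaterThan ennreal_power
          powr_realpow[symmetric] powr_powr mult.commute del: powr_divide)
  next
    case False
    \<comment> \<open>For t < m the tail formula does not apply; there the whole mass lies above
      t.\<close>
    have one: "emeasure (pareto m \<beta>) {t<..} = 1" if "0 < \<beta>" for \<beta>
    proof -
      have "emeasure (pareto m \<beta>) {t<..} =
          (\<integral>\<^sup>+x. ennreal (pareto_density m \<beta> x) * indicator {t<..} x \<partial>lborel)"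
        by (simp add: pareto_def emeasure_density)
      also have "\<dots> = (\<integral>\<^sup>+x. ennreal (pareto_density m \<beta> x) \<partial>lborel)"
        using False by (intro nn_integral_cong) (auto simp: pareto_density_def split: split_indicator)
      finally show ?thesis using assms that by (simp add: nn_integral_pareto_density)
    qed
    show ?thesis using assms by (simp add: emeasure_sample_min_greaterThan one)
  qed
  show "cdf ?D = cdf ?P"
  proof
    fix t
    have "cdf M t = 1 - measure M {t<..}" if "real_distribution M" for M
    proof -
      interpret M: real_distribution M by fact
      have "M.prob (space M - {t<..}) = 1 - M.prob {t<..}"
        by (rule M.prob_compl) simp
      also have "space M - {t<..} = {..t}" by auto
      finally show ?thesis by (simp add: cdf_def)
    qed
    then show "cdf ?D t = cdf ?P t"
      using D P tail by (simp add: measure_def)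
  qed
qed

text \<open>Passing to the law with shape \<alpha>1 leaves a function of the sample minimum alone.
  Under Pareto(m, n \<alpha>1) this function is the density ratio to Pareto(m, n \<alpha>0), so its
  integral is a total mass.\<close>

lemma nn_integral_E_star:
  assumes "1 \<le> n" "0 < m" "0 < \<alpha>0" "0 < \<alpha>1"
  shows "(\<integral>\<^sup>+x. E_star n \<alpha>0 \<alpha>1 x \<partial>pareto_sample n m \<alpha>0) = 1"
proof -
  let ?c = "real n * (\<alpha>1 - \<alpha>0)"
  let ?g = "\<lambda>y. ennreal (\<alpha>0 / \<alpha>1 * (y / m) powr ?c)"
  have "(\<integral>\<^sup>+x. E_star n \<alpha>0 \<alpha>1 x \<partial>pareto_sample n m \<alpha>0) =
      (\<integral>\<^sup>+x. ennreal (joint_density n m \<alpha>1 x) * ?g (sample_min n x) \<partial>(\<Pi>\<^sub>M i\<in>{1..n}. lborel))"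
    unfolding nn_integral_pareto_sample[OF assms(2,3) borel_measurable_E_star]
    by (intro nn_integral_cong) (metis joint_density_E_star[OF assms] mult.commute)
  also have "\<dots> = (\<integral>\<^sup>+x. ?g (sample_min n x) \<partial>pareto_sample n m \<alpha>1)"
    using assms by (intro nn_integral_pareto_sample[symmetric]) measurable
  also have "\<dots> = (\<integral>\<^sup>+y. ?g y \<partial>distr (pareto_sample n m \<alpha>1) borel (sample_min n))"
    by (intro nn_integral_distr[symmetric]) measurable
  also have "\<dots> = (\<integral>\<^sup>+y. ?g y \<partial>pareto m (real n * \<alpha>1))"
    using assms by (simp add: distr_sample_min)
  also have "\<dots> = (\<integral>\<^sup>+y. ennreal (pareto_density m (real n * \<alpha>1) y) * ?g y \<partial>lborel)"
    unfolding pareto_def by (intro nn_integral_density) measurable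
  also have "\<dots> = (\<integral>\<^sup>+y. ennreal (pareto_density m (real n * \<alpha>0) y) \<partial>lborel)"
  proof (rule nn_integral_cong)
    fix y :: real
    have "pareto_density m (real n * \<alpha>1) y * (\<alpha>0 / \<alpha>1 * (y / m) powr ?c) =
        pareto_density m (real n * \<alpha>0) y"
    proof (cases "m \<le> y")
      case True
      then have "0 < y" using assms by linarith
      have "real n * \<alpha>1 = real n * \<alpha>0 + ?c" by (simp add: algebra_simps)
      then have "m powr (real n * \<alpha>1) = m powr (real n * \<alpha>0) * m powr ?c"
        "y powr (real n * \<alpha>1 + 1) = y powr (real n * \<alpha>0 + 1) * y powr ?c"
        by (metis powr_add, metis powr_add add.commute add.left_commute)
      then show ?thesis
        using True \<open>0 < y\<close> assms by (simp add: pareto_density_def powr_divide)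
    qed (simp add: pareto_density_def)
    then show "ennreal (pareto_density m (real n * \<alpha>1) y) * ?g y =
        ennreal (pareto_density m (real n * \<alpha>0) y)"
      using assms by (simp add: ennreal_mult'[symmetric] pareto_density_nonneg)
  qed
  also have "\<dots> = 1"
    using assms by (intro nn_integral_pareto_density) auto
  finally show ?thesis .
qed

section \<open>Mixing over the scale\<close>

text \<open>Evaluates the mixtures, where prior and likelihood leave a power of m on [1, y]. The
  logarithmic case c = 0 arises when the two shapes coincide.\<close>

lemma nn_integral_powr_Icc:
  fixes c y :: real
  assumes "1 \<le> y"
  shows "(\<integral>\<^sup>+m. ennreal (m powr (c - 1)) * indicator {1..y} m \<partial>lborel) =
    ennreal (if c = 0 then ln y else (y powr c - 1) / c)"
proof -
  define F where "F t = (if c = 0 then ln t else (t powr c - 1) / c)" for t :: real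
  have "(\<integral>\<^sup>+m. ennreal (m powr (c - 1)) * indicator {1..y} m \<partial>lborel) = ennreal (F y - F 1)"
  proof (rule nn_integral_FTC_Icc)
    fix t assume "t \<in> {1..y}"
    then have "0 < t" by auto
    then show "(F has_real_derivative t powr (c - 1)) (at t)"
      unfolding F_def
      by (cases "c = 0") (auto intro!: derivative_eq_intros simp: powr_minus_divide)
  qed (use assms in auto)
  then show ?thesis by (simp add: F_def)
qed

text \<open>The priors are crossed so that under both mixtures the logarithm of the sample minimum is a sum
  of two independent exponential variables with rates \<open>n \<alpha>0\<close> and \<open>n \<alpha>1\<close>. The factor \<open>E_star n \<alpha>1 \<alpha>0\<close>
  is the reciprocal of \<open>E_star n \<alpha>0 \<alpha>1\<close>.\<close>

lemma marginal_likelihood_E_star: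
  assumes "1 \<le> n" "0 < \<alpha>0" "0 < \<alpha>1"
  shows "(\<integral>\<^sup>+m. ennreal (pareto_density 1 (real n * \<alpha>0) m) * ennreal (joint_density n m \<alpha>1 x) \<partial>lborel)
      * E_star n \<alpha>1 \<alpha>0 x =
    (\<integral>\<^sup>+m. ennreal (pareto_density 1 (real n * \<alpha>1) m) * ennreal (joint_density n m \<alpha>0 x) \<partial>lborel)"
    (is "?L * _ = ?R")
proof -
  define y where "y = sample_min n x"
  have meas: "(\<lambda>m. ennreal (pareto_density 1 \<beta> m) * ennreal (joint_density n m \<alpha> x))
      \<in> borel_measurable lborel" for \<alpha> \<beta>
  proof -
    \<comment> \<open>Here x is arbitrary and may lie outside the product space, so this is not
      taken as a section of the joint measurability.\<close>
    have "(\<lambda>m. joint_density n m \<alpha> x) = (\<lambda>m. \<Prod>i\<in>{1..n}. \<alpha> * m powr \<alpha> / x i powr (\<alpha> + 1) *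
        (if m \<le> x i then 1 else 0))"
      by (auto simp: joint_density_def pareto_density_def fun_eq_iff indicator_def intro!: prod.cong)
    then have [measurable]: "(\<lambda>m. joint_density n m \<alpha> x) \<in> borel_measurable borel" by simp
    show ?thesis by measurable
  qed
  \<comment> \<open>The prior forces 1 \<le> m and the likelihood forces m \<le> y.\<close>
  have zero: "ennreal (pareto_density 1 \<beta> m) * ennreal (joint_density n m \<alpha> x) = 0"
    if "\<not> (1 \<le> m \<and> m \<le> y)" for \<alpha> \<beta> m
    using that assms by (auto simp: y_def pareto_density_def joint_density_eq_0 not_le)
  show ?thesis
  proof (cases "1 \<le> y")
    case False
    then have "ennreal (pareto_density 1 \<beta> m) * ennreal (joint_density n m \<alpha> x) = 0" for \<alpha> \<beta> m
      by (intro zero) auto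
    then show ?thesis by (simp only: nn_integral_const mult_zero_left)
  next
    case True
    define c where "c = real n * (\<alpha>1 - \<alpha>0)"
    \<comment> \<open>The factors of the right-hand integrand that are free of m: n \<alpha>1 from
      the prior, the rest from the likelihood.\<close>
    define K where "K = real n * \<alpha>1 * \<alpha>0 ^ n * (\<Prod>i\<in>{1..n}. x i) powr (- (\<alpha>0 + 1))"
    have K: "0 \<le> K" using assms by (simp add: K_def)
    \<comment> \<open>\<open>joint_density_E_star\<close> with the shapes exchanged turns the
      likelihood at \<alpha>1 into that at \<alpha>0. Its factor \<alpha>1 / \<alpha>0 changes the
      prior's constant n \<alpha>0 into n \<alpha>1, so the same K appears as on the other
      side.\<close>
    have left: "ennreal (pareto_density 1 (real n * \<alpha>0) m) * ennreal (joint_density n m \<alpha>1 x) *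
        E_star n \<alpha>1 \<alpha>0 x = ennreal (K * y powr (- c)) * (ennreal (m powr (c - 1)) * indicator {1..y} m)"
      for m
    proof (cases "1 \<le> m \<and> m \<le> y")
      case True
      then have m: "0 < m" "0 < y" by linarith+
      have "pareto_density 1 (real n * \<alpha>0) m *
          (\<alpha>1 / \<alpha>0 * (y / m) powr (real n * (\<alpha>0 - \<alpha>1)) * joint_density n m \<alpha>0 x) =
        K * y powr (- c) * (m powr (- (real n * \<alpha>0 + 1)) * m powr c * m powr (real n * \<alpha>0))"
      proof -
        have "(y / m) powr (real n * (\<alpha>0 - \<alpha>1)) = (y / m) powr (- c)"
          by (simp add: c_def algebra_simps)
        also have "\<dots> = y powr (- c) * m powr c"
          using m powr_minus_divide[of m c] by (simp add: powr_divide)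
        finally have *: "(y / m) powr (real n * (\<alpha>0 - \<alpha>1)) = y powr (- c) * m powr c" .
        have **: "pareto_density 1 (real n * \<alpha>0) m = real n * \<alpha>0 * m powr (- (real n * \<alpha>0 + 1))"
          using True powr_minus_divide[of m "real n * \<alpha>0 + 1"] by (simp add: pareto_density_def)
        show ?thesis
          unfolding * ** using True m assms by (simp add: joint_density_eq y_def[symmetric] K_def)
      qed
      also have "m powr (- (real n * \<alpha>0 + 1)) * m powr c * m powr (real n * \<alpha>0) = m powr (c - 1)"
        by (simp add: powr_add[symmetric])
      finally have *: "pareto_density 1 (real n * \<alpha>0) m *
          (\<alpha>1 / \<alpha>0 * (y / m) powr (real n * (\<alpha>0 - \<alpha>1)) * joint_density n m \<alpha>0 x) =
        K * y powr (- c) * m powr (c - 1)" .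
      have Ky: "0 \<le> K * y powr (- c)" using K by simp
      have ind: "indicator {1..y} m = (1::ennreal)" using True by simp
      have p: "0 \<le> pareto_density 1 (real n * \<alpha>0) m"
        using assms by (simp add: pareto_density_nonneg)
      have q: "0 \<le> \<alpha>1 / \<alpha>0 * (y / m) powr (real n * (\<alpha>0 - \<alpha>1))"
        using assms by simp
      have "ennreal (pareto_density 1 (real n * \<alpha>0) m) * ennreal (joint_density n m \<alpha>1 x) *
          E_star n \<alpha>1 \<alpha>0 x = ennreal (pareto_density 1 (real n * \<alpha>0) m) *
          (ennreal (\<alpha>1 / \<alpha>0 * (y / m) powr (real n * (\<alpha>0 - \<alpha>1))) * ennreal (joint_density n m \<alpha>0 x))"
        using m assms by (simp only: mult.assoc joint_density_E_star y_def)
      also have "\<dots> = ennreal (K * y powr (- c) * m powr (c - 1))"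
        unfolding *[symmetric]
        by (simp only: ennreal_mult'[OF p] ennreal_mult'[OF q])
      finally show ?thesis
        using True by (simp only: ennreal_mult'[OF Ky] ind mult_1_right)
    qed (use zero in auto)
    have right: "ennreal (pareto_density 1 (real n * \<alpha>1) m) * ennreal (joint_density n m \<alpha>0 x) =
        ennreal K * (ennreal (m powr (- c - 1)) * indicator {1..y} m)" for m
    proof (cases "1 \<le> m \<and> m \<le> y")
      case True
      then have m: "0 < m" "0 < y" by linarith+
      have "pareto_density 1 (real n * \<alpha>1) m = real n * \<alpha>1 * m powr (- (real n * \<alpha>1 + 1))"
        using True powr_minus_divide[of m "real n * \<alpha>1 + 1"] by (simp add: pareto_density_def)
      then have "pareto_density 1 (real n * \<alpha>1) m * joint_density n m \<alpha>0 x =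
          K * (m powr (- (real n * \<alpha>1 + 1)) * m powr (real n * \<alpha>0))"
        using True m assms by (simp add: joint_density_eq y_def[symmetric] K_def)
      also have "m powr (- (real n * \<alpha>1 + 1)) * m powr (real n * \<alpha>0) = m powr (- c - 1)"
        by (simp add: powr_add[symmetric] c_def algebra_simps)
      finally show ?thesis
        using True assms K by (simp add: ennreal_mult'[symmetric] pareto_density_nonneg)
    qed (use zero in auto)
    have "?L * E_star n \<alpha>1 \<alpha>0 x =
        (\<integral>\<^sup>+m. ennreal (K * y powr (- c)) * (ennreal (m powr (c - 1)) * indicator {1..y} m) \<partial>lborel)"
      unfolding nn_integral_multc[OF meas, symmetric] left ..
    also have "\<dots> = ennreal (K * y powr (- c)) * ennreal (if c = 0 then ln y else (y powr c - 1) / c)"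
      using True by (subst nn_integral_cmult) (simp_all add: nn_integral_powr_Icc)
    also have "\<dots> = ennreal (K * (y powr (- c) * (if c = 0 then ln y else (y powr c - 1) / c)))"
      using K by (simp add: ennreal_mult'[symmetric] mult.assoc)
    \<comment> \<open>The substitution of y / m for m on [1, y], which reverses the sign of c,
      checked here on the closed forms.\<close>
    also have "y powr (- c) * (if c = 0 then ln y else (y powr c - 1) / c) =
        (if - c = 0 then ln y else (y powr (- c) - 1) / (- c))"
      using True by (simp add: powr_minus field_simps)
    also have "ennreal (K * \<dots>) = ennreal K * ennreal \<dots>"
      using K by (rule ennreal_mult')
    also have "\<dots> = ?R"
      unfolding right using True nn_integral_powr_Icc[of y "- c"]
      by (subst nn_integral_cmult) simp_all
    finally show ?thesis .
  qed
qed

lemma borel_measurable_ln_ennreal [measurable]: "ln_ennreal \<in> borel_measurable borel"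
  unfolding ln_ennreal_def by measurable

text \<open>Tonelli, with the prior written as a density: averaging the means of F over m amounts to
  integrating F against the marginal likelihood. The measurability claim serves the strict
  comparison of integrals over m.\<close>

lemma nn_integral_mixture:
  assumes [measurable]: "F \<in> borel_measurable (\<Pi>\<^sub>M i\<in>{1..n}. borel)"
  shows "(\<integral>\<^sup>+m. (\<integral>\<^sup>+x. ennreal (joint_density n m \<alpha> x) * F x \<partial>(\<Pi>\<^sub>M i\<in>{1..n}. lborel)) \<partial>pareto 1 \<beta>) =
    (\<integral>\<^sup>+x. (\<integral>\<^sup>+m. ennreal (pareto_density 1 \<beta> m) * ennreal (joint_density n m \<alpha> x) \<partial>lborel) * F x
      \<partial>(\<Pi>\<^sub>M i\<in>{1..n}. lborel))"
    (is "?lhs = ?rhs")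
    and "(\<lambda>m. \<integral>\<^sup>+x. ennreal (joint_density n m \<alpha> x) * F x \<partial>(\<Pi>\<^sub>M i\<in>{1..n}. lborel))
      \<in> borel_measurable borel" (is ?meas)
proof -
  define L :: "(nat \<Rightarrow> real) measure" where "L = (\<Pi>\<^sub>M i\<in>{1..n}. lborel)"
  interpret P: product_sigma_finite "\<lambda>_::nat. lborel :: real measure" ..
  interpret L: sigma_finite_measure L unfolding L_def by (rule P.sigma_finite) simp
  interpret PL: pair_sigma_finite lborel L ..
  have F [measurable]: "F \<in> borel_measurable L"
    unfolding L_def using assms by (simp add: measurable_cong_sets[OF sets_PiM_lborel refl])
  have J [measurable]: "(\<lambda>(m, x). joint_density n m \<alpha> x) \<in> borel_measurable (lborel \<Otimes>\<^sub>M L)"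
    using borel_measurable_joint_density unfolding L_def
    by (simp add: measurable_cong_sets[OF sets_pair_measure_cong[OF sets_lborel refl] refl])
  have JF [measurable]: "(\<lambda>(m, x). ennreal (joint_density n m \<alpha> x) * F x) \<in> borel_measurable (lborel \<Otimes>\<^sub>M L)"
    by measurable
  have meas: "(\<lambda>m. \<integral>\<^sup>+x. ennreal (joint_density n m \<alpha> x) * F x \<partial>L) \<in> borel_measurable lborel"
    using L.borel_measurable_nn_integral_fst[OF JF] by simp
  then show ?meas by (simp add: L_def)
  have "?lhs = (\<integral>\<^sup>+m. ennreal (pareto_density 1 \<beta> m) *
      (\<integral>\<^sup>+x. ennreal (joint_density n m \<alpha> x) * F x \<partial>L) \<partial>lborel)"
    unfolding pareto_def L_def[symmetric] using meas by (intro nn_integral_density) measurable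
  also have "\<dots> = (\<integral>\<^sup>+m. (\<integral>\<^sup>+x. ennreal (pareto_density 1 \<beta> m) * ennreal (joint_density n m \<alpha> x) * F x \<partial>L) \<partial>lborel)"
    by (subst nn_integral_cmult[symmetric]) (auto simp: mult.assoc)
  also have "\<dots> = (\<integral>\<^sup>+x. (\<integral>\<^sup>+m. ennreal (pareto_density 1 \<beta> m) * ennreal (joint_density n m \<alpha> x) * F x \<partial>lborel) \<partial>L)"
    by (intro PL.Fubini'[symmetric]) measurable
  also have "\<dots> = ?rhs"
    unfolding L_def[symmetric] by (intro nn_integral_cong nn_integral_multc) measurable
  finally show "?lhs = ?rhs" .
qed

text \<open>If the mean exceeded 1 at every scale, so would its average over the prior Pareto(1, n
  \<alpha>0). That average equals the mean of E under the null mixture with prior Pareto(1, n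
  \<alpha>1), which is at most 1.\<close>

lemma e_variable_exists_scale:
  assumes "1 \<le> n" "0 < \<alpha>0" "0 < \<alpha>1" "E \<in> e_variables n \<alpha>0"
  shows "\<exists>m>0. (\<integral>\<^sup>+x. E x * E_star n \<alpha>1 \<alpha>0 x \<partial>pareto_sample n m \<alpha>1) \<le> 1"
proof (rule ccontr)
  let ?L = "\<Pi>\<^sub>M i\<in>{1..n}. lborel :: real measure"
  let ?F = "\<lambda>x. E x * E_star n \<alpha>1 \<alpha>0 x"
  let ?R = "\<lambda>m. \<integral>\<^sup>+x. ennreal (joint_density n m \<alpha>1 x) * ?F x \<partial>?L"
  let ?Q = "\<lambda>\<alpha>. pareto 1 (real n * \<alpha>)"
  assume "\<not> (\<exists>m>0. (\<integral>\<^sup>+x. ?F x \<partial>pareto_sample n m \<alpha>1) \<le> 1)"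
  moreover have E [measurable]: "E \<in> borel_measurable (\<Pi>\<^sub>M i\<in>{1..n}. borel)"
    using assms by (simp add: e_variables_def)
  have F: "?F \<in> borel_measurable (\<Pi>\<^sub>M i\<in>{1..n}. borel)" by measurable
  ultimately have R: "1 < ?R m" if "0 < m" for m
    using that nn_integral_pareto_sample[OF that assms(3) F] by (auto simp: not_le)
  interpret Q0: prob_space "?Q \<alpha>0" using assms by (intro prob_space_pareto) auto
  interpret Q1: prob_space "?Q \<alpha>1" using assms by (intro prob_space_pareto) auto
  have pos: "AE m in ?Q \<alpha>. 0 < m" for \<alpha>
    unfolding pareto_def by (subst AE_density) (auto simp: pareto_density_def indicator_def)
  have "1 = (\<integral>\<^sup>+m. 1 \<partial>?Q \<alpha>0)"
    by (simp add: Q0.emeasure_space_1 del: space_pareto)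
  \<comment> \<open>A pointwise strict bound stays strict after integration because the prior has
    positive mass: equality almost everywhere would make \<open>False\<close> hold almost
    everywhere.\<close>
  also have "\<dots> < (\<integral>\<^sup>+m. ?R m \<partial>?Q \<alpha>0)"
  proof (rule nn_integral_less)
    show "?R \<in> borel_measurable (?Q \<alpha>0)"
      using nn_integral_mixture(2)[OF F] by simp
    show "AE m in ?Q \<alpha>0. 1 \<le> ?R m"
      using pos by eventually_elim (use R in \<open>auto intro: less_imp_le\<close>)
    show "\<not> (AE m in ?Q \<alpha>0. ?R m \<le> 1)"
    proof
      assume "AE m in ?Q \<alpha>0. ?R m \<le> 1"
      with pos have "AE m in ?Q \<alpha>0. False"
        by eventually_elim (use R in \<open>auto simp: not_le[symmetric]\<close>)
      then show False by simp
    qed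
  qed (simp_all add: Q0.emeasure_space_1 del: space_pareto)
  also have "\<dots> = (\<integral>\<^sup>+x. (\<integral>\<^sup>+m. ennreal (pareto_density 1 (real n * \<alpha>0) m) *
      ennreal (joint_density n m \<alpha>1 x) \<partial>lborel) * ?F x \<partial>?L)"
    by (rule nn_integral_mixture(1)[OF F])
  \<comment> \<open>The factor \<open>E_star n \<alpha>1 \<alpha>0\<close> converts the marginal
    likelihood of the alternative into that of the null.\<close>
  also have "\<dots> = (\<integral>\<^sup>+x. (\<integral>\<^sup>+m. ennreal (pareto_density 1 (real n * \<alpha>1) m) *
      ennreal (joint_density n m \<alpha>0 x) \<partial>lborel) * E x \<partial>?L)"
    unfolding marginal_likelihood_E_star[OF assms(1-3), symmetric]
    by (simp only: mult_ac)
  also have "\<dots> = (\<integral>\<^sup>+m. (\<integral>\<^sup>+x. ennreal (joint_density n m \<alpha>0 x) * E x \<partial>?L) \<partial>?Q \<alpha>1)"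
    by (rule nn_integral_mixture(1)[OF E, symmetric])
  also have "\<dots> \<le> (\<integral>\<^sup>+m. 1 \<partial>?Q \<alpha>1)"
  proof (rule nn_integral_mono_AE)
    show "AE m in ?Q \<alpha>1. (\<integral>\<^sup>+x. ennreal (joint_density n m \<alpha>0 x) * E x \<partial>?L) \<le> 1"
      using pos
    proof eventually_elim
      case (elim m)
      then show ?case
        using assms nn_integral_pareto_sample[OF elim assms(2) E] by (auto simp: e_variables_def)
    qed
  qed
  also have "\<dots> = 1" by (simp add: Q1.emeasure_space_1 del: space_pareto)
  finally show False by simp
qed

section \<open>Comparing expected logarithms in the extended reals\<close>

text \<open>All three come from log t \<le> t - 1, applied to t = E H or t = H with H = 1 / G. The
  first is arranged as sums of nonnegative terms, so that infinite values cause no subtraction; the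
  other two control the parts whose infinity would spoil the later differences.\<close>

lemma ln_ennreal_add_le:
  assumes "G * H = 1"
  shows "e2ennreal (ln_ennreal E) + e2ennreal (- ln_ennreal G) + 1 \<le>
    e2ennreal (- ln_ennreal E) + e2ennreal (ln_ennreal G) + E * H"
    and "e2ennreal (ln_ennreal E) \<le> e2ennreal (ln_ennreal G) + E * H"
    and "e2ennreal (- ln_ennreal G) \<le> H"
proof -
  \<comment> \<open>A product with an infinite factor is 0 or infinite, never 1.\<close>
  obtain g h where GH: "G = ennreal g" "H = ennreal h" "0 \<le> g" "0 \<le> h"
    using assms by (cases G; cases H) (auto simp: ennreal_mult_eq_top_iff ennreal_top_mult ennreal_mult_top split: if_splits)
  have gh: "g * h = 1" using assms GH by (simp add: ennreal_mult'[symmetric])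
  then have g: "0 < g" "0 < h" using GH by (auto simp: less_le)
  have lnG: "ln_ennreal G = ereal (ln g)" using g GH by (simp add: ln_ennreal_def)
  have lnh: "ln h = - ln g" using gh g by (metis add_eq_0_iff ln_mult ln_one less_irrefl)
  have real_le: "ln r - ln g + 1 \<le> r * h" if "0 < r" for r
    using ln_le_minus_one[of "r * h"] that g lnh by (simp add: ln_mult)
  have "e2ennreal (ln_ennreal E) + e2ennreal (- ln_ennreal G) + 1 \<le>
      e2ennreal (- ln_ennreal E) + e2ennreal (ln_ennreal G) + E * H \<and>
      e2ennreal (ln_ennreal E) \<le> e2ennreal (ln_ennreal G) + E * H"
  proof (cases E)
    case (real r)
    \<comment> \<open>For E = 0 the negative part of its logarithm is infinite, so the right-hand
      sum is infinite.\<close>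
    show ?thesis
    proof (cases "r = 0")
      case True
      then show ?thesis using real by (simp add: ln_ennreal_def e2ennreal_neg)
    next
      case False
      then have r: "0 < r" using real by simp
      have lnE: "ln_ennreal E = ereal (ln r)" using r real by (simp add: ln_ennreal_def)
      have EH: "E * H = ennreal (r * h)" using GH real by (simp add: ennreal_mult)
      have rh: "0 \<le> r * h" using r g by simp
      \<comment> \<open>\<open>real_le\<close> with each logarithm split into positive and negative
        part, the negative parts moved across.\<close>
      have "max 0 (ln r) + max 0 (- ln g) + 1 \<le> max 0 (- ln r) + max 0 (ln g) + r * h"
        using real_le[OF r] rh by linarith
      from ennreal_leI[OF this]
      have "ennreal (ln r) + ennreal (- ln g) + 1 \<le> ennreal (- ln r) + ennreal (ln g) + ennreal (r * h)"
        using rh by simp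
      moreover have "max 0 (ln r) \<le> max 0 (ln g) + r * h"
        using real_le[OF r] rh by linarith
      from ennreal_leI[OF this] have "ennreal (ln r) \<le> ennreal (ln g) + ennreal (r * h)"
        using rh by simp
      ultimately show ?thesis
        unfolding lnE lnG EH by simp
    qed
  next
    case top
    then show ?thesis using g GH by (simp add: ennreal_top_mult)
  qed
  then show "e2ennreal (ln_ennreal E) + e2ennreal (- ln_ennreal G) + 1 \<le>
      e2ennreal (- ln_ennreal E) + e2ennreal (ln_ennreal G) + E * H"
    "e2ennreal (ln_ennreal E) \<le> e2ennreal (ln_ennreal G) + E * H"
    by auto
  have "- ln g \<le> h" using ln_le_minus_one[OF g(2)] lnh by simp
  moreover have "e2ennreal (- ln_ennreal G) = ennreal (- ln g)" by (simp add: lnG)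
  ultimately show "e2ennreal (- ln_ennreal G) \<le> H"
    using GH by (simp add: ennreal_leI)
qed

text \<open>Integrates the subtraction-free inequality over a probability space. The bound on the
  mean of E H cancels the constant 1, and that on the mean of H keeps the negative part of log G
  integrable.\<close>

lemma ext_expectation_ln_le:
  assumes "prob_space M"
    and [measurable]: "E \<in> borel_measurable M" "G \<in> borel_measurable M" "H \<in> borel_measurable M"
    and inv: "\<And>x. G x * H x = 1"
    and EH: "(\<integral>\<^sup>+x. E x * H x \<partial>M) \<le> 1" and H: "(\<integral>\<^sup>+x. H x \<partial>M) \<le> 1"
  shows "ext_expectation M (\<lambda>x. ln_ennreal (E x)) \<le> ext_expectation M (\<lambda>x. ln_ennreal (G x))"
proof -
  interpret prob_space M by fact
  let ?A = "\<integral>\<^sup>+x. e2ennreal (ln_ennreal (E x)) \<partial>M" and ?B = "\<integral>\<^sup>+x. e2ennreal (- ln_ennreal (E x)) \<partial>M"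
  let ?C = "\<integral>\<^sup>+x. e2ennreal (ln_ennreal (G x)) \<partial>M" and ?D = "\<integral>\<^sup>+x. e2ennreal (- ln_ennreal (G x)) \<partial>M"
  let ?R = "\<integral>\<^sup>+x. E x * H x \<partial>M"
  have "(\<integral>\<^sup>+x. e2ennreal (ln_ennreal (E x)) + e2ennreal (- ln_ennreal (G x)) + 1 \<partial>M) \<le>
      (\<integral>\<^sup>+x. e2ennreal (- ln_ennreal (E x)) + e2ennreal (ln_ennreal (G x)) + E x * H x \<partial>M)"
    by (intro nn_integral_mono ln_ennreal_add_le inv)
  then have "?A + ?D + 1 \<le> ?B + ?C + ?R"
    by (simp add: nn_integral_add emeasure_space_1)
  also have "\<dots> \<le> ?B + ?C + 1" by (intro add_left_mono EH)
  finally have le: "?A + ?D \<le> ?B + ?C" by simp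
  have "?A \<le> (\<integral>\<^sup>+x. e2ennreal (ln_ennreal (G x)) + E x * H x \<partial>M)"
    by (intro nn_integral_mono ln_ennreal_add_le inv)
  also have "\<dots> = ?C + ?R" by (simp add: nn_integral_add)
  also have "\<dots> \<le> ?C + 1" by (intro add_left_mono EH)
  finally have A: "?A \<le> ?C + 1" .
  have "?D \<le> (\<integral>\<^sup>+x. H x \<partial>M)" by (intro nn_integral_mono ln_ennreal_add_le inv)
  then have D: "?D \<le> 1" using H by (rule order_trans)
  \<comment> \<open>Sums become differences by cases: d is finite, so an infinite c makes the right
    side infinite; otherwise a is finite, and an infinite b makes the left side minus infinity. What
    remains is real arithmetic.\<close>
  have *: "enn2ereal a - enn2ereal b \<le> enn2ereal c - enn2ereal d"
    if le: "a + d \<le> b + c" and a_le: "a \<le> c + 1" and d_le: "d \<le> 1" for a b c d :: ennreal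
  proof -
    obtain d' where d: "d = ennreal d'" "0 \<le> d'" using d_le by (cases d) (auto simp: top_unique)
    show ?thesis
    proof (cases c)
      case top
      then show ?thesis using d by (simp add: enn2ereal_ennreal)
    next
      case c: (real c')
      then have "c + 1 < top" by (auto simp: ennreal_add_less_top)
      then obtain a' where a: "a = ennreal a'" "0 \<le> a'" using a_le by (cases a) (auto simp: top_unique)
      show ?thesis
      proof (cases b)
        case top
        then show ?thesis using a by (simp add: enn2ereal_ennreal)
      next
        case b: (real b')
        have "a' + d' \<le> b' + c'"
          using le a b c d by (simp add: ennreal_plus[symmetric] del: ennreal_plus)
        then show ?thesis using a b c d by (simp add: enn2ereal_ennreal)
      qed
    qed
  qed
  show ?thesis
    unfolding ext_expectation_def by (rule *[OF le A D])
qed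

section \<open>Scale invariance and optimality of \<open>E_star\<close>\<close>

lemma E_star_scale:
  assumes "1 \<le> n" "0 < m"
  shows "E_star n \<alpha>0 \<alpha>1 (compose {1..n} ((*) m) x) = E_star n \<alpha>0 \<alpha>1 x"
proof -
  have "sample_min n (compose {1..n} ((*) m) x) = Min ((*) m ` (x ` {1..n}))"
    unfolding sample_min_def by (intro arg_cong[where f = Min]) (auto simp: compose_def)
  also have "\<dots> = m * sample_min n x"
    unfolding sample_min_def using assms
    \<comment> \<open>Multiplication by m > 0 is monotone and so commutes with the minimum; the
      ratios to the minimum are then unchanged.\<close>
    by (intro mono_Min_commute[symmetric]) (auto intro!: monoI mult_left_mono)
  finally show ?thesis
    using assms by (simp add: E_star_def compose_def)
qed

text \<open>The law at scale m is the image of the law at scale 1, and \<open>E_star\<close> takes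
  the same values along that map. Its worst-case growth is therefore attained at every m.\<close>

lemma ext_expectation_E_star:
  assumes "1 \<le> n" "0 < m" "0 < \<alpha>"
  shows "ext_expectation (pareto_sample n m \<alpha>) (\<lambda>x. ln_ennreal (E_star n \<alpha>0 \<alpha>1 x)) =
    ext_expectation (pareto_sample n 1 \<alpha>) (\<lambda>x. ln_ennreal (E_star n \<alpha>0 \<alpha>1 x))"
proof -
  have [measurable]: "compose {1..n} ((*) m) \<in> measurable (pareto_sample n 1 \<alpha>) (\<Pi>\<^sub>M i\<in>{1..n}. borel)"
    unfolding compose_def by measurable
  show ?thesis
    unfolding ext_expectation_def pareto_sample_scale[OF assms(2,3)]
    by (simp add: nn_integral_distr E_star_scale[OF assms(1,2)] del: One_nat_def)
qed

theorem mainTheorem9: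
  fixes n :: nat and \<alpha>0 \<alpha>1 :: real
  assumes "n \<ge> 2" and "\<alpha>0 > 0" and "\<alpha>1 > 0"
    and "real n * \<alpha>1 > 1"
  shows "GROW_e_variable n \<alpha>0 \<alpha>1 (E_star n \<alpha>0 \<alpha>1)"
proof -
  let ?S = "E_star n \<alpha>0 \<alpha>1"
  have n: "1 \<le> n" using assms by simp
  have S: "?S \<in> e_variables n \<alpha>0"
    using assms n by (simp add: e_variables_def nn_integral_E_star borel_measurable_E_star del: One_nat_def)
  have "worst_case_growth n \<alpha>1 E \<le> worst_case_growth n \<alpha>1 ?S" if E: "E \<in> e_variables n \<alpha>0" for E
  proof -
    \<comment> \<open>This m depends on E. One such scale suffices, since the infimum for E is at
      most the value at m.\<close>
    obtain m where m: "0 < m" "(\<integral>\<^sup>+x. E x * E_star n \<alpha>1 \<alpha>0 x \<partial>pareto_sample n m \<alpha>1) \<le> 1"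
      using e_variable_exists_scale[OF n assms(2,3) E] by blast
    have [measurable]: "E \<in> borel_measurable (\<Pi>\<^sub>M i\<in>{1..n}. borel)"
      using E by (simp add: e_variables_def)
    have "worst_case_growth n \<alpha>1 E \<le> ext_expectation (pareto_sample n m \<alpha>1) (\<lambda>x. ln_ennreal (E x))"
      unfolding worst_case_growth_def using m by (intro INF_lower) auto
    also have "\<dots> \<le> ext_expectation (pareto_sample n m \<alpha>1) (\<lambda>x. ln_ennreal (?S x))"
    proof (rule ext_expectation_ln_le)
      show "prob_space (pareto_sample n m \<alpha>1)"
        by (rule prob_space_pareto_sample[OF m(1) assms(3)])
      show "?S x * E_star n \<alpha>1 \<alpha>0 x = 1" for x
        by (rule E_star_cancel[OF assms(2,3)])
      \<comment> \<open>Exchanging the shapes makes \<alpha>1 the null, under which the reciprocal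
        of \<open>E_star\<close> has mean 1.\<close>
      show "(\<integral>\<^sup>+x. E_star n \<alpha>1 \<alpha>0 x \<partial>pareto_sample n m \<alpha>1) \<le> 1"
        by (simp only: nn_integral_E_star[OF n m(1) assms(3,2)] order_refl)
    qed (use m in measurable)
    also have "\<dots> = ext_expectation (pareto_sample n 1 \<alpha>1) (\<lambda>x. ln_ennreal (?S x))"
      by (rule ext_expectation_E_star[OF n m(1) assms(3)])
    also have "\<dots> = (INF m'\<in>{0::real<..}. ext_expectation (pareto_sample n 1 \<alpha>1) (\<lambda>x. ln_ennreal (?S x)))"
      by (rule cINF_const[symmetric]) auto
    also have "\<dots> = worst_case_growth n \<alpha>1 ?S"
      unfolding worst_case_growth_def
      by (intro INF_cong refl ext_expectation_E_star[OF n _ assms(3), symmetric]) simp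
    finally show ?thesis .
  qed
  then show ?thesis
    unfolding GROW_e_variable_def using S by (auto intro!: antisym SUP_upper SUP_least)
qed

end
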